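(* Let $(a,b)$, $a<b$, be an interval of the real line of non-asymptotic length (i.e. fixed, not depending on $M$). For each $M$ let $\beta_1,\dots,\beta_M$ be the real numbers constructed from $(a,b)$ as in the context, i.e. $\beta_l=a+\alpha_l(b-a)/z$, $l=1,\dots,M$. Then $\beta_1,\dots,\beta_M$ lie on the interval $(a,b)$ and form a Badly Approximable $M$-tuple, so that, as $M\to\infty$ (that is, for all sufficiently large $M$), one has $$\max_{i=1,2,\dots,M}|\beta_i q-p_i|\ \ge\ B_0\,\exp(-6M\ln M)\,q^{-1/M}$$ for any integers $q>0$ and $p_1,p_2,\dots,p_M$, and for some constant $B_0>0$ independent of $M$, $q$ and $p_1,p_2,\dots,p_M$. In other words, the constant $B(M)$ in the definition of a Badly Approximable $M$-tuple can be taken as $B(M)=B_0\exp(-6M\ln M)$.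
   Context: Badly Approximable (BA) $M$-tuple: real numbers $\beta_1,\dots,\beta_M$ such that for some constant $B(M)>0$, dependent on $M$ and on $\beta_1,\dots,\beta_M$ but independent of $q$ and $p_1,\dots,p_M$, one has $\max_{i=1,\dots,M}|\beta_i q-p_i|\ge B(M)q^{-1/M}$ for all integers $q>0$ and $p_1,\dots,p_M$. Construction ($M$ is assumed large enough). Choose a positive integer $Q\ge 5(M+1)$ and let $\xi_1,\dots,\xi_{M+1}$ be the (real) roots of the polynomial $(x-Q)(x-2Q)\cdots(x-(M+1)Q)-1$, numbered so that $(i-1/2)Q<\xi_i<(i+1/2)Q$, $i=1,\dots,M+1$. Let $(\alpha_1,\dots,\alpha_M)$ be the unique solution of the linear system $\sum_{i=1}^M\xi_k^{i-1}\alpha_i=-\xi_k^M$, $k=1,\dots,M$. It is assumed, without loss of generality, that $a$ and $b$ are rational; otherwise $(a,b)$ is replaced by an interval $(a^*,b^* )\subset(a,b)$ with $a^*$ and $b^*$ rational. Let $z$ be the integer with $z-1<30\exp(3M\ln M)\le z$. Put $\beta_l=a+\alpha_l(b-a)/z$, $l=1,\dots,M$.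
   Formalization: Since α_M = -(ξ_1+…+ξ_M) < 0, β_M < a, so membership in (a,b) is stated for the tuple with |α_l|; the constant for both tuples. Both claims fail for huge Q and are stated for 5(M+1) ≤ Q ≤ M²; bad approximability for all Q ≥ 5(M+1). *)

theory Defs
  imports Complex_Main "HOL-Computational_Algebra.Polynomial"
begin

text \<open>Tuples indexed by \<open>1..M\<close> are functions on \<^typ>\<open>nat\<close>; values outside \<open>{1..M}\<close> are irrelevant.\<close>

definition badly_approximable_with :: "real \<Rightarrow> nat \<Rightarrow> (nat \<Rightarrow> real) \<Rightarrow> bool" where
  "badly_approximable_with B M \<beta> \<longleftrightarrow>
     (\<forall>(q::int) (p::nat \<Rightarrow> int). q > 0 \<longrightarrow>
        (MAX i\<in>{1..M}. \<bar>\<beta> i * of_int q - of_int (p i)\<bar>) \<ge> B * of_int q powr (- 1 / real M))"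

definition badly_approximable :: "nat \<Rightarrow> (nat \<Rightarrow> real) \<Rightarrow> bool" where
  "badly_approximable M \<beta> \<longleftrightarrow> (\<exists>B>0. badly_approximable_with B M \<beta>)"

definition base_poly :: "nat \<Rightarrow> nat \<Rightarrow> real poly" where
  "base_poly M Q = (\<Prod>j=1..M+1. [:- real (j * Q), 1:]) - 1"

definition xi :: "nat \<Rightarrow> nat \<Rightarrow> nat \<Rightarrow> real" where
  "xi M Q i = (THE x. poly (base_poly M Q) x = 0 \<and>
                 (real i - 1/2) * real Q < x \<and> x < (real i + 1/2) * real Q)"

text \<open>The solution of the linear system is made unique as a function by extending it by \<open>0\<close>.\<close>

definition alpha :: "nat \<Rightarrow> nat \<Rightarrow> nat \<Rightarrow> real" where
  "alpha M Q = (THE \<alpha>.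
     (\<forall>k\<in>{1..M}. (\<Sum>i=1..M. xi M Q k ^ (i - 1) * \<alpha> i) = - (xi M Q k ^ M)) \<and>
     (\<forall>i. i \<notin> {1..M} \<longrightarrow> \<alpha> i = 0))"

definition scale :: "nat \<Rightarrow> int" where
  "scale M = \<lceil>30 * exp (3 * real M * ln (real M))\<rceil>"

text \<open>
  By Vieta, \<open>alpha M Q l\<close> is \<open>(- 1) ^ (M - l + 1)\<close> times an elementary symmetric polynomial
  of the positive numbers \<open>xi M Q 1, \<dots>, xi M Q M\<close>. The signs alternate, and the point
  \<open>a + \<alpha> l * (b - a) / scale M\<close> lies to the left of \<open>a\<close> whenever \<open>\<alpha> l < 0\<close>. For this reason
  \<open>\<alpha>\<close> is a parameter below: it is instantiated both with \<open>alpha M Q\<close> and with the absolute values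
  of its entries, and only the latter tuple lies in the interval.
\<close>

definition beta :: "real \<Rightarrow> real \<Rightarrow> nat \<Rightarrow> (nat \<Rightarrow> real) \<Rightarrow> nat \<Rightarrow> real" where
  "beta a b M \<alpha> l = a + \<alpha> l * (b - a) / of_int (scale M)"

end

theory Submission
  imports Defs Jordan_Normal_Form.Char_Poly
begin

text \<open>
  The polynomial \<open>P = (x - Q)\<cdots>(x - (M+1)Q) - 1\<close> is monic, irreducible over \<open>\<int>\<close>, and has
  \<open>M + 1\<close> real roots \<open>\<xi>\<^sub>k\<close>. Hence for integers \<open>q > 0\<close> and \<open>p\<^sub>i\<close> the product over all roots of
  \<open>L\<^sub>k = q \<xi>\<^sub>k\<^sup>M + \<Sum>i. p\<^sub>i \<xi>\<^sub>k\<^sup>i\<^sup>-\<^sup>1\<close> is a nonzero integer. With \<open>d = max \<bar>\<alpha>\<^sub>i q - p\<^sub>i\<bar>\<close>, the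
  first \<open>M\<close> factors are \<open>O(d)\<close> and the last one is \<open>O(q)\<close>, so \<open>d\<^sup>M q\<close> is bounded below; keeping track
  of the constants gives \<open>d \<ge> q\<^sup>-\<^sup>1\<^sup>/\<^sup>M / (6 (Q M)\<^sup>M)\<close>. The affine rational map from \<open>\<alpha>\<close> to \<open>\<beta>\<close>
  costs another factor of order \<open>scale M\<close>, and \<open>(Q M)\<^sup>M \<le> exp (3 M ln M)\<close> when \<open>Q \<le> M\<^sup>2\<close>.
\<close>

section \<open>Norms of integer polynomials at the roots of an irreducible polynomial\<close>

text \<open>In a factorization \<open>f * g\<close> the factors take opposite values
  \<open>1\<close> and \<open>-1\<close> at every point \<open>c j\<close>. If both degrees are
  below \<open>card A\<close>, these \<open>card A\<close> coincidences force
  \<open>f = - g\<close>, and then \<open>- g * g\<close> cannot have leading coefficient 1.\<close>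

lemma irreducible_prod_linear_minus_one:
  fixes c :: "'a \<Rightarrow> int"
  assumes "finite A" "A \<noteq> {}" "inj_on c A"
  shows "Factorial_Ring.irreducible ((\<Prod>j\<in>A. [:- c j, 1:]) - 1)"
proof -
  let ?P = "(\<Prod>j\<in>A. [:- c j, 1:]) - 1"
  let ?n = "card A"
  have n0: "?n > 0" using assms by (simp add: card_gt_0_iff)
  have degQ: "degree (\<Prod>j\<in>A. [:- c j, 1:]) = ?n"
    by (subst degree_prod_eq_sum_degree) auto
  have lcQ: "lead_coeff (\<Prod>j\<in>A. [:- c j, 1:]) = 1"
    by (simp add: lead_coeff_prod)
  have deg: "degree ?P = ?n"
    using degQ n0 by (metis degree_add_eq_left degree_minus degree_1 diff_conv_add_uminus)
  have lc: "lead_coeff ?P = 1" 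
    using lcQ n0 degQ unfolding deg by simp
  have P0: "?P \<noteq> 0" using lc by auto
  show ?thesis
  proof (rule irreducibleI)
    show "?P \<noteq> 0" by (rule P0)
    show "\<not> ?P dvd 1" using deg n0 by (auto simp: is_unit_poly_iff)
  next
    fix f g assume fg: "?P = f * g"
    have f0: "f \<noteq> 0" and g0: "g \<noteq> 0" using P0 fg by auto
    have dfg: "degree f + degree g = ?n" using deg fg f0 g0 by (simp add: degree_mult_eq)
    have lfg: "lead_coeff f * lead_coeff g = 1" using lc unfolding fg by (simp add: lead_coeff_mult)
    have unit: "h dvd 1" if "degree h = 0" "is_unit (lead_coeff h)" for h :: "int poly"
      using that by (auto simp: is_unit_poly_iff elim!: degree_eq_zeroE)
    consider "degree f = 0" | "degree g = 0" | "degree f < ?n" "degree g < ?n"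
      using dfg by linarith
    then show "f dvd 1 \<or> g dvd 1"
    proof cases
      case 1
      then show ?thesis using unit[of f] lfg by (metis dvd_triv_left)
    next
      case 2
      then show ?thesis using unit[of g] lfg by (metis dvd_triv_right)
    next
      case 3
      have "f = - g"
      proof (rule poly_eqI_degree[of "c ` A"])
        fix x assume "x \<in> c ` A"
        then have "poly ?P x = -1"
          using assms(1) by (auto simp: poly_prod prod_zero_iff)
        then have "poly f x * poly g x = -1" unfolding fg by simp
        then show "poly f x = poly (- g) x"
          by (metis (no_types) mult_minus_right poly_minus minus_minus zmult_eq_1_iff)
      qed (use 3 assms in \<open>auto simp: card_image\<close>)
      then have "lead_coeff f = - lead_coeff g" by simp
      with lfg have "- (lead_coeff g * lead_coeff g) = 1" by simp
      moreover have "lead_coeff g * lead_coeff g \<ge> 0" by simp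
      ultimately show ?thesis by linarith
    qed
  qed
qed

text \<open>Pseudo-division scales the dividend by a power of the leading coefficient of
  \<open>P\<close>. For monic \<open>P\<close> this power is 1, so division with remainder works
  without passing to fractions.\<close>

lemma monic_division:
  fixes f P :: "'a :: idom poly"
  assumes "lead_coeff P = 1" "degree P > 0"
  obtains h r where "f = P * h + r" "degree r < degree P"
proof -
  obtain h r where hr: "pseudo_divmod f P = (h, r)" by force
  from assms have "P \<noteq> 0" by auto
  from pseudo_divmod[OF this hr] assms have "f = P * h + r" "degree r < degree P" by auto
  then show ?thesis by (rule that)
qed

lemma poly_sum_lessThan:
  fixes p :: "'a :: comm_semiring_1 poly"
  assumes "degree p < n"
  shows "poly p x = (\<Sum>i<n. poly.coeff p i * x ^ i)"
  unfolding poly_altdef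
  by (rule sum.mono_neutral_left) (use assms in \<open>auto simp: coeff_eq_0\<close>)

text \<open>The product is, up to conjugation by the Vandermonde matrix of the roots, the determinant
  of the integer matrix of multiplication by \<open>g\<close> on \<open>\<int>[x]/(P)\<close>.\<close>

lemma abs_prod_poly_roots_ge_1:
  fixes P g :: "int poly" and r :: "nat \<Rightarrow> real"
  assumes lc: "lead_coeff P = 1" and irr: "Factorial_Ring.irreducible P"
    and inj: "inj_on r {..<degree P}"
    and root: "\<And>k. k < degree P \<Longrightarrow> poly (map_poly of_int P) (r k) = 0"
    and g: "g \<noteq> 0" "degree g < degree P"
  shows "1 \<le> \<bar>\<Prod>k<degree P. poly (map_poly of_int g) (r k)\<bar>"
proof -
  define n where "n = degree P"
  have n0: "n > 0" using g by (simp add: n_def)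
  have "\<exists>h R. Polynomial.monom 1 i * g = P * h + R \<and> degree R < n" for i
    using monic_division[of P "Polynomial.monom 1 i * g"] lc n0 unfolding n_def by metis
  then obtain h R where hR: "\<And>i. Polynomial.monom 1 i * g = P * h i + R i"
    and degR: "\<And>i. degree (R i) < n" by metis
  \<comment> \<open>Column \<open>i\<close> of \<open>H\<close> holds the coordinates of
    \<open>x ^ i * g\<close> modulo \<open>P\<close>, and \<open>W\<close> is the Vandermonde matrix
    of the roots. Evaluating the remainders at the roots gives \<open>W * H = D * W\<close>.\<close>
  define H where "H = mat n n (\<lambda>(j, i). poly.coeff (R i) j)"
  define W where "W = mat n n (\<lambda>(k, j). r k ^ j)"
  define G where "G k = poly (map_poly of_int g) (r k)" for k
  define D where "D = mat n n (\<lambda>(k, j). if k = j then G k else 0)"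
  have carr: "H \<in> carrier_mat n n" "W \<in> carrier_mat n n" "D \<in> carrier_mat n n"
    by (auto simp: H_def W_def D_def)
  have eval: "(\<Sum>j<n. r k ^ j * of_int (poly.coeff (R i) j)) = G k * r k ^ i" if "k < n" for i k
  proof -
    have "map_poly real_of_int (Polynomial.monom 1 i * g) = map_poly of_int (P * h i + R i)" using hR by simp
    then have "poly (map_poly real_of_int (Polynomial.monom 1 i * g)) (r k)
      = poly (map_poly of_int (P * h i + R i)) (r k)" by simp
    then have "G k * r k ^ i = poly (map_poly of_int (R i)) (r k)"
      using root[of k] that n_def by (simp add: hom_distribs G_def poly_monom mult.commute)
    also have "\<dots> = (\<Sum>j<n. r k ^ j * of_int (poly.coeff (R i) j))"
      by (subst poly_sum_lessThan[of _ n]) (use degR in \<open>auto simp: mult.commute\<close>)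
    finally show ?thesis by simp
  qed
  have "W * map_mat of_int H = D * W"
  proof (rule eq_matI)
    fix k i assume "k < dim_row (D * W)" "i < dim_col (D * W)"
    then have ki: "k < n" "i < n" by (auto simp: D_def W_def)
    have "(W * map_mat of_int H) $$ (k, i) = (\<Sum>j<n. r k ^ j * of_int (poly.coeff (R i) j))"
      using ki by (simp add: W_def H_def scalar_prod_def atLeast0LessThan)
    moreover have "(D * W) $$ (k, i) = G k * r k ^ i"
      using ki by (simp add: W_def D_def scalar_prod_def atLeast0LessThan if_distrib[of "\<lambda>x. x * _"] cong: if_cong)
    ultimately show "(W * map_mat of_int H) $$ (k, i) = (D * W) $$ (k, i)"
      using eval ki by simp
  qed (auto simp: W_def H_def D_def)
  then have "det W * of_int (det H) = det D * det W"
    using det_mult[of W n "map_mat of_int H"] det_mult[of D n W] carr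
    by (auto simp: of_int_hom.hom_det)
  moreover have "det D = (\<Prod>k<n. G k)"
  proof -
    have "det D = prod_list (diag_mat D)"
      by (rule det_upper_triangular[OF _ carr(3)]) (auto simp: D_def upper_triangular_def)
    also have "\<dots> = (\<Prod>k<n. G k)"
      by (simp add: prod_list_diag_prod D_def atLeast0LessThan)
    finally show ?thesis .
  qed
  \<comment> \<open>A kernel vector of \<open>W\<close> would be the coefficient list of a nonzero
    polynomial of degree below \<open>n\<close> with \<open>n\<close> distinct roots.\<close>
  moreover have "det W \<noteq> 0"
  proof
    assume "det W = 0"
    then obtain v where v: "v \<in> carrier_vec n" "v \<noteq> 0\<^sub>v n" "W *\<^sub>v v = 0\<^sub>v n"
      using det_0_iff_vec_prod_zero carr by blast
    define p where "p = (\<Sum>i<n. Polynomial.monom (v $ i) i)"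
    have cp: "poly.coeff p i = (if i < n then v $ i else 0)" for i
      by (simp add: p_def coeff_sum if_distrib cong: if_cong)
    have "p = 0"
    proof (rule poly_eqI_degree[of "r ` {..<n}"])
      fix x assume "x \<in> r ` {..<n}"
      then obtain k where k: "k < n" "x = r k" by auto
      have "(W *\<^sub>v v) $ k = 0" using v k by simp
      then have "(\<Sum>j<n. r k ^ j * v $ j) = 0"
        using k v by (simp add: W_def scalar_prod_def atLeast0LessThan carrier_vecD)
      then show "poly p x = poly 0 x"
        by (simp add: p_def poly_sum poly_monom k mult.commute)
    next
      have "degree p < n" using n0 by (intro degree_lessI) (auto simp: cp)
      then show "degree p < card (r ` {..<n})" using inj by (simp add: card_image n_def)
      then show "degree 0 < card (r ` {..<n})" by simp
    qed
    then have "v = 0\<^sub>v n" using v cp by (intro eq_vecI) (auto, metis coeff_0)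
    with v show False by simp
  qed
  ultimately have det: "of_int (det H) = (\<Prod>k<n. G k)" by simp
  \<comment> \<open>A kernel vector of \<open>H\<close> can be taken integral, so it gives a nonzero
    integer polynomial \<open>u\<close> of degree below \<open>n\<close> with \<open>P\<close>
    dividing \<open>u * g\<close>. Irreducible elements of the integer polynomial ring are prime, so
    \<open>P\<close> would divide a nonzero polynomial of smaller degree.\<close>
  have "det H \<noteq> 0"
  proof
    assume "det H = 0"
    then obtain v where v: "v \<in> carrier_vec n" "v \<noteq> 0\<^sub>v n" "H *\<^sub>v v = 0\<^sub>v n"
      using det_0_iff_vec_prod_zero carr by blast
    define u where "u = (\<Sum>i<n. Polynomial.monom (v $ i) i)"
    have cu: "poly.coeff u i = (if i < n then v $ i else 0)" for i
      by (simp add: u_def coeff_sum if_distrib cong: if_cong)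
    have degu: "degree u < n" using n0 by (intro degree_lessI) (auto simp: cu)
    have u0: "u \<noteq> 0"
    proof
      assume "u = 0"
      then have "v = 0\<^sub>v n" using v cu by (intro eq_vecI) (auto, metis coeff_0)
      with v show False by simp
    qed
    have R0: "(\<Sum>i<n. Polynomial.smult (v $ i) (R i)) = 0"
    proof (rule poly_eqI)
      fix j
      show "poly.coeff (\<Sum>i<n. Polynomial.smult (v $ i) (R i)) j = poly.coeff 0 j"
      proof (cases "j < n")
        case True
        have "(H *\<^sub>v v) $ j = 0" using v True by simp
        then show ?thesis using True v
          by (simp add: H_def scalar_prod_def atLeast0LessThan carrier_vecD coeff_sum mult.commute)
      next
        case False
        then show ?thesis using degR
          by (simp add: coeff_sum coeff_eq_0[OF less_le_trans[OF degR]])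
      qed
    qed
    have "u * g = (\<Sum>i<n. Polynomial.smult (v $ i) (Polynomial.monom 1 i * g))"
      unfolding u_def sum_distrib_right mult_smult_left[symmetric] smult_monom by simp
    also have "\<dots> = P * (\<Sum>i<n. Polynomial.smult (v $ i) (h i))"
      by (simp add: hR smult_add_right sum.distrib R0 sum_distrib_left)
    finally have "P dvd u * g" by simp
    then have "P dvd u \<or> P dvd g"
      using irr by (meson irreducible_imp_prime_elem prime_elem_dvd_mult_iff)
    then show False using u0 g degu dvd_imp_degree_le[of P u] dvd_imp_degree_le[of P g]
      unfolding n_def by linarith
  qed
  then have "1 \<le> \<bar>real_of_int (det H)\<bar>" by linarith
  then show ?thesis unfolding det by (simp add: G_def n_def)
qed

section \<open>Coefficients of products of linear factors\<close>

lemma degree_prod_linear: "degree (\<Prod>j\<in>A. [:c j, 1 :: 'b :: idom:]) = card A"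
  by (subst degree_prod_eq_sum_degree) auto

lemma coeff_linear_mult:
  "poly.coeff ([:c, 1 :: 'a :: comm_ring_1:] * p) i
     = c * poly.coeff p i + (if i = 0 then 0 else poly.coeff p (i - 1))"
  by (cases i) auto

text \<open>Substituting \<open>- x\<close> for \<open>x\<close> turns one product into the other up
  to the factor \<open>(-1) ^ card S\<close>.\<close>

lemma coeff_prod_linear_neg:
  fixes c :: "'a \<Rightarrow> real"
  assumes "finite S"
  shows "poly.coeff (\<Prod>k\<in>S. [:- c k, 1:]) i = (-1) ^ (card S + i) * poly.coeff (\<Prod>k\<in>S. [:c k, 1:]) i"
  using assms
proof (induction S arbitrary: i)
  case empty
  then show ?case by (cases i) auto
next
  case (insert x S)
  then show ?case by (cases i) (simp_all add: coeff_linear_mult algebra_simps del: mult_pCons_left)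
qed

lemma coeff_prod_linear_pos:
  fixes c :: "'a \<Rightarrow> real"
  assumes "finite S" "\<And>k. k \<in> S \<Longrightarrow> 0 < c k"
  shows "0 \<le> poly.coeff (\<Prod>k\<in>S. [:c k, 1:]) i"
    and "i \<le> card S \<Longrightarrow> 0 < poly.coeff (\<Prod>k\<in>S. [:c k, 1:]) i"
  using assms
proof (induction S arbitrary: i)
  case empty
  { case 1 then show ?case by (cases i) auto }
  { case 2 then show ?case by auto }
next
  case (insert x S)
  note IH = insert.IH
  { case 1
    then have "0 \<le> c x" "\<And>j. 0 \<le> poly.coeff (\<Prod>k\<in>S. [:c k, 1:]) j"
      using IH(1) by (auto intro: less_imp_le)
    then show ?case using insert.hyps
      by (simp add: coeff_linear_mult del: mult_pCons_left) }
  { case 2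
    then have c: "0 < c x" "\<And>k. k \<in> S \<Longrightarrow> 0 < c k" by auto
    show ?case
    proof (cases i)
      case 0
      then show ?thesis using insert.hyps IH(2)[of 0] c
        by (simp add: coeff_linear_mult del: mult_pCons_left)
    next
      \<comment> \<open>For the top coefficient, \<open>i = card S + 1\<close>, the term with
        \<open>c x\<close> vanishes. Strict positivity therefore comes from coefficient
        \<open>j\<close>, with only the weak bound at \<open>i\<close>.\<close>
      case (Suc j)
      then have "0 < poly.coeff (\<Prod>k\<in>S. [:c k, 1:]) j" using IH(2)[of j] c 2 insert.hyps by simp
      moreover have "0 \<le> c x * poly.coeff (\<Prod>k\<in>S. [:c k, 1:]) i" using IH(1)[of i] c by simp
      ultimately show ?thesis using insert.hyps Suc
        by (simp add: coeff_linear_mult del: mult_pCons_left)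
    qed }
qed

text \<open>Up to sign these are the coefficients of the product with positive \<open>c k\<close>.
  Each of them is at most the sum of all coefficients, which is the value of that product at
  1.\<close>

lemma abs_coeff_prod_linear_bounds:
  fixes c :: "'a \<Rightarrow> real"
  assumes "finite S" "\<And>k. k \<in> S \<Longrightarrow> 0 < c k" "i \<le> card S"
  shows "0 < \<bar>poly.coeff (\<Prod>k\<in>S. [:- c k, 1:]) i\<bar>"
    and "\<bar>poly.coeff (\<Prod>k\<in>S. [:- c k, 1:]) i\<bar> \<le> (\<Prod>k\<in>S. 1 + c k)"
proof -
  let ?p = "\<Prod>k\<in>S. [:c k, 1:]"
  have eq: "\<bar>poly.coeff (\<Prod>k\<in>S. [:- c k, 1:]) i\<bar> = poly.coeff ?p i"
    using coeff_prod_linear_pos(1)[of S c i] assms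
    by (simp add: coeff_prod_linear_neg abs_mult)
  then show "0 < \<bar>poly.coeff (\<Prod>k\<in>S. [:- c k, 1:]) i\<bar>"
    using coeff_prod_linear_pos(2)[of S c i] assms by simp
  have "poly.coeff ?p i \<le> (\<Sum>j\<le>degree ?p. poly.coeff ?p j)"
    using assms coeff_prod_linear_pos(1)[of S c] by (intro member_le_sum) (auto simp: degree_prod_linear)
  also have "\<dots> = poly ?p 1" by (simp add: poly_altdef)
  also have "\<dots> = (\<Prod>k\<in>S. 1 + c k)" by (simp add: poly_prod add.commute)
  finally show "\<bar>poly.coeff (\<Prod>k\<in>S. [:- c k, 1:]) i\<bar> \<le> (\<Prod>k\<in>S. 1 + c k)" using eq by simp
qed

section \<open>Two elementary inequalities\<close>

text \<open>Serves to bound the value at \<open>x\<close> of a polynomial of degree at most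
  \<open>n\<close> whose coefficients are uniformly bounded.\<close>

lemma sum_power_le_one_plus_power:
  fixes x :: real
  assumes "0 \<le> x"
  shows "(\<Sum>i<Suc n. x ^ i) \<le> (1 + x) ^ n"
proof (induction n)
  case (Suc n)
  have "x ^ n \<le> (1 + x) ^ n" using assms by (intro power_mono) auto
  then have "x * x ^ n \<le> x * (1 + x) ^ n" using assms by (intro mult_left_mono)
  with Suc show ?case by (simp add: algebra_simps)
qed simp

text \<open>The product is the factorial of \<open>n + 1\<close>. The induction rests on
  \<open>2 * n ^ n \<le> (n + 1) ^ n\<close>, which is Bernoulli's inequality for
  \<open>(1 + 1 / n) ^ n\<close>.\<close>

lemma prod_plus_one_le_power:
  assumes "1 \<le> n"
  shows "(\<Prod>k=1..n. real k + 1) \<le> 2 * real n ^ n"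
  using assms
proof (induction n rule: dec_induct)
  case (step n)
  have "(real n + 2) * real n ^ n \<le> real n ^ n * (1 + (real n + 1))" by (simp add: algebra_simps)
  also have "\<dots> \<le> real (Suc n) ^ Suc n"
  proof -
    have *: "real (Suc n) ^ Suc n = (real n + 1) * (real n + 1) ^ n" by (simp add: add.commute)
    have "(1 + real n * (1 / real n)) \<le> (1 + 1 / real n) ^ n"
      using order_trans[of "- 1" 0 "1 / real n"] by (intro Bernoulli_inequality) simp
    then have "2 \<le> (1 + 1 / real n) ^ n" using step by simp
    then have "2 * real n ^ n \<le> (1 + 1 / real n) ^ n * real n ^ n" by (intro mult_right_mono) auto
    also have "\<dots> = (real n + 1) ^ n" using step by (simp add: field_simps flip: power_mult_distrib)
    finally have "(real n + 1) * (2 * real n ^ n) \<le> real (Suc n) ^ Suc n"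
      unfolding * by (intro mult_left_mono) auto
    moreover have "real n ^ n * (1 + (real n + 1)) \<le> (real n + 1) * (2 * real n ^ n)"
      by (simp add: algebra_simps)
    ultimately show ?thesis by linarith
  qed
  finally have "(real n + 2) * real n ^ n \<le> real (Suc n) ^ Suc n" .
  moreover have "(\<Prod>k=1..n. real k + 1) * (real n + 2) \<le> (2 * real n ^ n) * (real n + 2)"
    using step by (intro mult_right_mono) auto
  ultimately show ?case by (simp add: algebra_simps)
qed simp

section \<open>The roots of the base polynomial\<close>

lemma poly_base_poly: "poly (base_poly M Q) x = (\<Prod>j=1..M+1. x - real j * real Q) - 1"
  by (simp add: base_poly_def poly_prod del: prod.cl_ivl_Suc)

text \<open>The product \<open>w\<close> of the linear factors changes sign between the two
  endpoints and exceeds 1 in modulus at both. Subtracting 1 thus keeps the sign change, and the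
  intermediate value theorem applies.\<close>

lemma base_poly_root_exists:
  assumes Q: "5 \<le> Q" and i: "i \<in> {1..M+1}"
  shows "\<exists>x. poly (base_poly M Q) x = 0 \<and>
    (real i - 1/2) * real Q < x \<and> x < (real i + 1/2) * real Q"
proof -
  define w where "w x = (\<Prod>j=1..M+1. x - real j * real Q)" for x
  let ?l = "(real i - 1/2) * real Q" and ?u = "(real i + 1/2) * real Q"
  \<comment> \<open>A half-integer is at distance at least \<open>1/2\<close> from every integer, so
    each factor has modulus at least \<open>Q / 2\<close>, which exceeds 2.\<close>
  have half: "1 < \<bar>w ((real_of_int k + 1/2) * real Q)\<bar>" for k
  proof -
    have "1 < (2::real) ^ card {1..M+1}" by (rule one_less_power) auto
    also have "\<dots> = (\<Prod>j=1..M+1. 2)" by simp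
    also have "\<dots> \<le> (\<Prod>j=1..M+1. \<bar>(real_of_int k + 1/2) * real Q - real j * real Q\<bar>)"
    proof (rule prod_mono, safe)
      fix j
      have "k - int j \<le> - 1 \<or> 0 \<le> k - int j" by linarith
      then have "real_of_int (k - int j) \<le> - 1 \<or> 0 \<le> real_of_int (k - int j)" by linarith
      then have "1/2 \<le> \<bar>real_of_int (k - int j) + 1/2\<bar>" by (auto simp: abs_if)
      then have "1/2 * 5 \<le> \<bar>real_of_int (k - int j) + 1/2\<bar> * real Q"
        using Q by (intro mult_mono) auto
      also have "\<dots> = \<bar>(real_of_int k + 1/2) * real Q - real j * real Q\<bar>"
        by (subst abs_mult_pos) (simp_all add: algebra_simps)
      finally show "2 \<le> \<bar>(real_of_int k + 1/2) * real Q - real j * real Q\<bar>" by simp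
    qed simp
    finally show ?thesis by (simp only: w_def abs_prod)
  qed
  have "w ?l * w ?u = (\<Prod>j=1..M+1. (?l - real j * real Q) * (?u - real j * real Q))"
    by (simp only: w_def prod.distrib)
  also have "\<dots> = ((?l - real i * real Q) * (?u - real i * real Q)) *
      (\<Prod>j\<in>{1..M+1} - {i}. (?l - real j * real Q) * (?u - real j * real Q))"
    by (rule prod.remove[OF _ i]) simp
  \<comment> \<open>Only the factor with \<open>j = i\<close> changes sign; for every other
    \<open>j\<close> the point \<open>j * Q\<close> lies on one side of the whole interval.\<close>
  also have "\<dots> < 0"
  proof (rule mult_neg_pos)
    show "(?l - real i * real Q) * (?u - real i * real Q) < 0"
      using Q by (simp add: algebra_simps)
    show "0 < (\<Prod>j\<in>{1..M+1} - {i}. (?l - real j * real Q) * (?u - real j * real Q))"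
    proof (rule prod_pos)
      fix j assume "j \<in> {1..M+1} - {i}"
      then consider "real j + 1 \<le> real i" | "real i + 1 \<le> real j" by fastforce
      then have "0 < ((real i - 1/2) - real j) * ((real i + 1/2) - real j)"
        by cases (auto intro!: mult_pos_pos mult_neg_neg)
      then have "0 < ((real i - 1/2) - real j) * ((real i + 1/2) - real j) * (real Q * real Q)"
        using Q by simp
      then show "0 < (?l - real j * real Q) * (?u - real j * real Q)"
        by (simp add: algebra_simps)
    qed
  qed
  finally have neg: "w ?l * w ?u < 0" .
  have wl: "1 < \<bar>w ?l\<bar>" using half[of "int i - 1"] by (simp add: algebra_simps)
  have wu: "1 < \<bar>w ?u\<bar>" using half[of "int i"] by simp
  have "(w ?l - 1) * (w ?u - 1) < 0"
    using neg wl wu by (auto simp: mult_less_0_iff)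
  then have "poly (base_poly M Q) ?l * poly (base_poly M Q) ?u < 0"
    by (simp only: poly_base_poly w_def)
  moreover have "?l < ?u" using Q by (simp add: algebra_simps)
  ultimately show ?thesis using poly_IVT[of ?l ?u] by blast
qed

lemma intervals_disjoint:
  fixes x :: real
  assumes "(real i - 1/2) * real Q < x" "x < (real i + 1/2) * real Q"
    and "(real j - 1/2) * real Q < x" "x < (real j + 1/2) * real Q"
  shows "i = j"
proof -
  have Q: "0 < real Q" using assms(1,2) by (cases "Q = 0") auto
  have "(real i - 1/2) * real Q < (real j + 1/2) * real Q" "(real j - 1/2) * real Q < (real i + 1/2) * real Q"
    using assms by linarith+
  then have "real i - 1/2 < real j + 1/2" "real j - 1/2 < real i + 1/2"
    using Q by (simp_all only: mult_less_cancel_right_pos)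
  then show ?thesis by linarith
qed

lemma degree_base_poly: "degree (base_poly M Q) = M + 1" "base_poly M Q \<noteq> 0"
proof -
  have *: "degree (\<Prod>j=1..M+1. [:- real (j * Q), 1:]) = M + 1"
    using degree_prod_linear[of "\<lambda>j. - real (j * Q)" "{1..M+1}"] by simp
  show "degree (base_poly M Q) = M + 1"
    unfolding base_poly_def using *
    by (metis Suc_eq_plus1 degree_1 degree_add_eq_left degree_minus diff_conv_add_uminus zero_less_Suc)
  then show "base_poly M Q \<noteq> 0" by auto
qed

text \<open>The \<open>M + 1\<close> disjoint intervals each contain a root, and a polynomial of
  degree \<open>M + 1\<close> has no further ones. The root in each interval is therefore unique, as
  the definite description in \<open>xi\<close> requires.\<close>

lemma xi_root:
  assumes Q: "5 \<le> Q" and i: "i \<in> {1..M+1}"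
  shows "poly (base_poly M Q) (xi M Q i) = 0 \<and>
    (real i - 1/2) * real Q < xi M Q i \<and> xi M Q i < (real i + 1/2) * real Q"
proof -
  have "\<forall>i\<in>{1..M+1}. \<exists>x. poly (base_poly M Q) x = 0 \<and>
    (real i - 1/2) * real Q < x \<and> x < (real i + 1/2) * real Q"
    using base_poly_root_exists[OF Q] by blast
  from bchoice[OF this] obtain r where r: "\<And>i. i \<in> {1..M+1} \<Longrightarrow> poly (base_poly M Q) (r i) = 0 \<and>
    (real i - 1/2) * real Q < r i \<and> r i < (real i + 1/2) * real Q"
    by blast
  let ?Z = "{x. poly (base_poly M Q) x = 0}"
  have "inj_on r {1..M+1}" by (rule inj_onI) (metis r intervals_disjoint)
  then have "card (r ` {1..M+1}) = M + 1" by (simp add: card_image)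
  moreover have "card ?Z \<le> M + 1"
    using card_poly_roots_bound[of "base_poly M Q"] degree_base_poly by simp
  moreover have "finite ?Z" using degree_base_poly by (simp add: poly_roots_finite)
  moreover have "r ` {1..M+1} \<subseteq> ?Z" using r by auto
  ultimately have Z: "?Z = r ` {1..M+1}" by (metis card_seteq)
  show ?thesis unfolding xi_def
  proof (rule theI[where a = "r i"])
    fix x assume x: "poly (base_poly M Q) x = 0 \<and>
      (real i - 1/2) * real Q < x \<and> x < (real i + 1/2) * real Q"
    then obtain j where "j \<in> {1..M+1}" "x = r j" using Z by blast
    with x r[of j] intervals_disjoint[of i Q x j] show "x = r i" by auto
  qed (use r i in auto)
qed

lemma inj_on_xi: "5 \<le> Q \<Longrightarrow> inj_on (xi M Q) {1..M+1}"
  by (rule inj_onI) (metis xi_root intervals_disjoint)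

lemma xi_bounds:
  assumes "5 \<le> Q" "i \<in> {1..M+1}"
  shows "0 < xi M Q i" "1 + xi M Q i \<le> (real i + 1) * real Q"
proof -
  have "0 \<le> (real i - 1/2) * real Q" using assms by auto
  then show "0 < xi M Q i" using xi_root[OF assms] by linarith
  have "xi M Q i < (real i + 1/2) * real Q" using xi_root[OF assms] by simp
  \<comment> \<open>The slack \<open>Q / 2\<close> absorbs the summand 1.\<close>
  then show "1 + xi M Q i \<le> (real i + 1) * real Q" using assms(1) by (simp add: algebra_simps)
qed

section \<open>The solution of the linear system\<close>

text \<open>The system says that the monic polynomial with lower coefficients
  \<open>\<alpha> 1\<close>, ..., \<open>\<alpha> M\<close> vanishes at the first \<open>M\<close>
  roots. A monic polynomial of degree \<open>M\<close> is determined by its values at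
  \<open>M\<close> points, which gives both existence and uniqueness.\<close>

lemma alpha_eq_coeff:
  assumes Q: "5 \<le> Q" and i: "i \<in> {1..M}"
  shows "alpha M Q i = poly.coeff (\<Prod>k=1..M. [:- xi M Q k, 1:]) (i - 1)"
proof -
  define F where "F = (\<Prod>k=1..M. [:- xi M Q k, 1:])"
  have degF: "degree F = M" using degree_prod_linear[of "\<lambda>k. - xi M Q k" "{1..M}"] by (simp add: F_def)
  have lcF: "poly.coeff F M = 1"
    using lead_coeff_prod[of "\<lambda>k. [:- xi M Q k, 1:]" "{1..M}"] degF by (simp add: F_def)
  define \<alpha> where "\<alpha> i = (if i \<in> {1..M} then poly.coeff F (i - 1) else 0)" for i
  have reindex: "(\<Sum>i=1..M. x ^ (i - 1) * f i) = (\<Sum>i<M. f (Suc i) * x ^ i)" for x :: real and f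
    by (rule sum.reindex_bij_witness[of _ Suc "\<lambda>i. i - 1"]) auto
  have root: "poly F (xi M Q k) = 0" if "k \<in> {1..M}" for k
    using that by (auto simp: F_def poly_prod intro!: prod_zero)
  have polyF: "poly F x = x ^ M + (\<Sum>i<M. poly.coeff F i * x ^ i)" for x
    using degF lcF by (simp add: poly_altdef lessThan_Suc_atMost[symmetric])
  have "alpha M Q = \<alpha>" unfolding alpha_def
  proof (rule the_equality)
    show "(\<forall>k\<in>{1..M}. (\<Sum>i=1..M. xi M Q k ^ (i - 1) * \<alpha> i) = - (xi M Q k ^ M)) \<and>
      (\<forall>i. i \<notin> {1..M} \<longrightarrow> \<alpha> i = 0)"
    proof (intro conjI ballI allI impI)
      fix k assume k: "k \<in> {1..M}"
      have "(\<Sum>i<M. \<alpha> (Suc i) * xi M Q k ^ i) = (\<Sum>i<M. poly.coeff F i * xi M Q k ^ i)"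
        by (rule sum.cong) (auto simp: \<alpha>_def)
      then show "(\<Sum>i=1..M. xi M Q k ^ (i - 1) * \<alpha> i) = - (xi M Q k ^ M)"
        using polyF[of "xi M Q k"] root[OF k] unfolding reindex by linarith
    qed (auto simp: \<alpha>_def)
  next
    fix \<gamma> assume \<gamma>: "(\<forall>k\<in>{1..M}. (\<Sum>i=1..M. xi M Q k ^ (i - 1) * \<gamma> i) = - (xi M Q k ^ M)) \<and>
      (\<forall>i. i \<notin> {1..M} \<longrightarrow> \<gamma> i = 0)"
    define G where "G = Polynomial.monom 1 M + (\<Sum>i<M. Polynomial.monom (\<gamma> (Suc i)) i)"
    have cG: "poly.coeff G i = (if i = M then 1 else if i < M then \<gamma> (Suc i) else 0)" for i
      by (simp add: G_def coeff_sum)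
    have "G = F"
    proof (rule poly_eqI_degree_lead_coeff[of _ M _ "xi M Q ` {1..M}"])
      show "poly.coeff G M = poly.coeff F M" using lcF cG by simp
      have "inj_on (xi M Q) {1..M}" by (rule inj_on_subset[OF inj_on_xi[OF Q]]) auto
      then show "M \<le> card (xi M Q ` {1..M})" by (simp add: card_image)
      show "degree G \<le> M" by (rule degree_le) (auto simp: cG)
      show "degree F \<le> M" using degF by simp
      fix z assume "z \<in> xi M Q ` {1..M}"
      then obtain k where k: "k \<in> {1..M}" "z = xi M Q k" by auto
      have "(\<Sum>i<M. \<gamma> (Suc i) * z ^ i) = - (z ^ M)" using \<gamma> k unfolding reindex by auto
      then have "poly G z = 0" by (simp add: G_def poly_sum poly_monom)
      then show "poly G z = poly F z" using root k by simp
    qed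
    show "\<gamma> = \<alpha>"
    proof
      fix i show "\<gamma> i = \<alpha> i"
      proof (cases "i \<in> {1..M}")
        case True
        then show ?thesis using cG[of "i - 1"] \<open>G = F\<close> by (auto simp: \<alpha>_def)
      qed (use \<gamma> in \<open>auto simp: \<alpha>_def\<close>)
    qed
  qed
  then show ?thesis using i by (simp add: \<alpha>_def F_def)
qed

lemma prod_xi_bound:
  assumes "5 \<le> Q" "1 \<le> M"
  shows "(\<Prod>k=1..M. (real k + 1) * real Q) \<le> 2 * (real Q * real M) ^ M"
proof -
  have "(\<Prod>k=1..M. (real k + 1) * real Q) = (\<Prod>k=1..M. real k + 1) * real Q ^ M"
    by (simp add: prod.distrib)
  also have "\<dots> \<le> (2 * real M ^ M) * real Q ^ M"
    using prod_plus_one_le_power[OF assms(2)] by (rule mult_right_mono) simp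
  finally show ?thesis by (simp add: power_mult_distrib mult_ac)
qed

text \<open>Positivity will place the points strictly to the right of the left endpoint; the upper
  bound, compared with \<open>scale M\<close>, keeps them to the left of the right one.\<close>

lemma abs_alpha_bounds:
  assumes Q: "5 \<le> Q" and i: "i \<in> {1..M}"
  shows "0 < \<bar>alpha M Q i\<bar>" "\<bar>alpha M Q i\<bar> \<le> 2 * (real Q * real M) ^ M"
proof -
  have pos: "\<And>k. k \<in> {1..M} \<Longrightarrow> 0 < xi M Q k" using xi_bounds(1)[OF Q] by simp
  have "i - 1 \<le> card {1..M}" using i by auto
  note * = abs_coeff_prod_linear_bounds[OF _ pos this]
  show "0 < \<bar>alpha M Q i\<bar>" using *(1) alpha_eq_coeff[OF Q i] by simp
  have "\<bar>alpha M Q i\<bar> \<le> (\<Prod>k=1..M. 1 + xi M Q k)" using *(2) alpha_eq_coeff[OF Q i] by simp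
  also have "\<dots> \<le> (\<Prod>k=1..M. (real k + 1) * real Q)"
  proof (rule prod_mono)
    fix k assume "k \<in> {1..M}"
    then show "0 \<le> 1 + xi M Q k \<and> 1 + xi M Q k \<le> (real k + 1) * real Q"
      using xi_bounds[OF Q, of k M] by simp
  qed
  also have "\<dots> \<le> 2 * (real Q * real M) ^ M" using prod_xi_bound[OF Q] i by simp
  finally show "\<bar>alpha M Q i\<bar> \<le> 2 * (real Q * real M) ^ M" .
qed

section \<open>Badly approximable tuples\<close>

text \<open>Trades the maximum for an arbitrary common bound \<open>d\<close>, the form in which all
  later estimates are made.\<close>

lemma badly_approximable_with_iff:
  assumes "1 \<le> M"
  shows "badly_approximable_with B M \<beta> \<longleftrightarrow>
    (\<forall>(q::int) (p::nat \<Rightarrow> int) d. q > 0 \<longrightarrow> (\<forall>i\<in>{1..M}. \<bar>\<beta> i * of_int q - of_int (p i)\<bar> \<le> d) \<longrightarrow>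
       B * of_int q powr (- 1 / real M) \<le> d)" (is "_ \<longleftrightarrow> ?R")
proof -
  have ne: "{1..M} \<noteq> {}" using assms by simp
  let ?m = "\<lambda>(q::int) (p::nat \<Rightarrow> int). MAX i\<in>{1..M}. \<bar>\<beta> i * of_int q - of_int (p i)\<bar>"
  have "?m q p \<le> d \<longleftrightarrow> (\<forall>i\<in>{1..M}. \<bar>\<beta> i * of_int q - of_int (p i)\<bar> \<le> d)" for q p d
    using ne by simp
  then have "?R \<longleftrightarrow> (\<forall>q p d. q > 0 \<longrightarrow> ?m q p \<le> d \<longrightarrow> B * of_int q powr (- 1 / real M) \<le> d)"
    by simp
  also have "\<dots> \<longleftrightarrow> badly_approximable_with B M \<beta>"
    unfolding badly_approximable_with_def by (blast intro: order_trans)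
  finally show ?thesis ..
qed

lemma badly_approximable_with_mono:
  assumes "1 \<le> M" "badly_approximable_with B M \<beta>" "B' \<le> B"
  shows "badly_approximable_with B' M \<beta>"
  unfolding badly_approximable_with_iff[OF assms(1)]
proof (intro allI impI)
  fix q :: int and p :: "nat \<Rightarrow> int" and d
  assume "q > 0" "\<forall>i\<in>{1..M}. \<bar>\<beta> i * of_int q - of_int (p i)\<bar> \<le> d"
  then have "B * of_int q powr (- 1 / real M) \<le> d"
    using assms(2) unfolding badly_approximable_with_iff[OF assms(1)] by blast
  moreover have "B' * of_int q powr (- 1 / real M) \<le> B * of_int q powr (- 1 / real M)"
    using assms(3) by (rule mult_right_mono) simp
  ultimately show "B' * of_int q powr (- 1 / real M) \<le> d" by linarith
qed

text \<open>Changing the sign of \<open>\<alpha> i\<close> together with that of \<open>p i\<close>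
  leaves the approximation error unchanged.\<close>

lemma badly_approximable_with_abs:
  assumes M: "1 \<le> M" and ba: "badly_approximable_with B M \<alpha>"
  shows "badly_approximable_with B M (\<lambda>i. \<bar>\<alpha> i\<bar>)"
  unfolding badly_approximable_with_iff[OF M]
proof (intro allI impI)
  fix q :: int and p :: "nat \<Rightarrow> int" and d
  assume q: "q > 0" and d: "\<forall>i\<in>{1..M}. \<bar>\<bar>\<alpha> i\<bar> * of_int q - of_int (p i)\<bar> \<le> d"
  define p' where "p' i = (if \<alpha> i < 0 then - p i else p i)" for i
  have "\<bar>\<alpha> i * of_int q - of_int (p' i)\<bar> = \<bar>\<bar>\<alpha> i\<bar> * of_int q - of_int (p i)\<bar>" for i
  proof (cases "\<alpha> i < 0")
    case True
    then have "\<alpha> i * of_int q - of_int (p' i) = - (\<bar>\<alpha> i\<bar> * of_int q - of_int (p i))"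
      by (simp add: p'_def)
    then show ?thesis by (simp only: abs_minus_cancel)
  qed (simp add: p'_def)
  then have "\<forall>i\<in>{1..M}. \<bar>\<alpha> i * of_int q - of_int (p' i)\<bar> \<le> d" using d by simp
  then show "B * of_int q powr (- 1 / real M) \<le> d"
    using ba q unfolding badly_approximable_with_iff[OF M] by blast
qed

lemma scale_bounds:
  "30 * exp (3 * real M * ln (real M)) \<le> of_int (scale M)"
  "of_int (scale M) \<le> 30 * exp (3 * real M * ln (real M)) + 1"
  by (simp_all add: scale_def of_int_ceiling_le_add_one le_of_int_ceiling)

lemma scale_pos: "0 < real_of_int (scale M)"
  using scale_bounds(1)[of M] by (smt (verit) exp_gt_zero)

text \<open>Multiplying \<open>\<beta> i * q - p i\<close> by \<open>D * scale M\<close> gives an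
  approximation error of \<open>\<alpha> i\<close> with the integer \<open>C * q\<close> in place of
  \<open>q\<close> and an integer numerator.\<close>

lemma badly_approximable_with_beta:
  fixes A C D :: int
  assumes M: "1 \<le> M" and ba: "badly_approximable_with c M \<alpha>" and c: "0 \<le> c"
    and C: "0 < C" and D: "0 < D" and a: "a = of_int A / of_int D" and ab: "b - a = of_int C / of_int D"
  shows "badly_approximable_with (c / (of_int C * of_int D * of_int (scale M))) M (beta a b M \<alpha>)"
  unfolding badly_approximable_with_iff[OF M]
proof (intro allI impI)
  fix q :: int and p :: "nat \<Rightarrow> int" and d
  let ?z = "scale M"
  assume q: "q > 0" and d: "\<forall>i\<in>{1..M}. \<bar>beta a b M \<alpha> i * of_int q - of_int (p i)\<bar> \<le> d"
  define Y where "Y = real_of_int D * real_of_int ?z"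
  have Y: "0 < Y" using D scale_pos by (simp add: Y_def)
  have "\<bar>\<alpha> i * of_int (C * q) - of_int (p i * D * ?z - A * q * ?z)\<bar> \<le> Y * d" if "i \<in> {1..M}" for i
  proof -
    have "\<alpha> i * of_int (C * q) - of_int (p i * D * ?z - A * q * ?z)
        = Y * (beta a b M \<alpha> i * of_int q - of_int (p i))"
      unfolding beta_def ab unfolding a using D scale_pos[of M] by (simp add: field_simps Y_def)
    then show ?thesis using d that Y by (simp add: abs_mult)
  qed
  then have "c * of_int (C * q) powr (- 1 / real M) \<le> Y * d"
    using q C ba[unfolded badly_approximable_with_iff[OF M], rule_format,
      of "C * q" "\<lambda>i. p i * D * ?z - A * q * ?z" "Y * d"] by simp
  \<comment> \<open>Replacing \<open>C powr (- 1 / M)\<close> by the smaller \<open>1 / C\<close>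
    makes the loss from \<open>C\<close> independent of \<open>M\<close>.\<close>
  moreover have "c * ((1 / of_int C) * of_int q powr (- 1 / real M)) \<le> c * of_int (C * q) powr (- 1 / real M)"
  proof (rule mult_left_mono[OF _ c])
    have "of_int C powr (-1) \<le> real_of_int C powr (- 1 / real M)"
      using C M by (intro powr_mono) (auto simp: field_simps)
    then have "1 / of_int C \<le> real_of_int C powr (- 1 / real M)"
      using C by (simp add: powr_minus inverse_eq_divide)
    then have "1 / of_int C * of_int q powr (- 1 / real M) \<le> real_of_int C powr (- 1 / real M) * of_int q powr (- 1 / real M)"
      by (rule mult_right_mono) simp
    then show "1 / of_int C * of_int q powr (- 1 / real M) \<le> real_of_int (C * q) powr (- 1 / real M)"
      using C q by (simp add: powr_mult)
  qed
  ultimately have "c / of_int C * of_int q powr (- 1 / real M) \<le> Y * d" by simp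
  then show "c / (of_int C * of_int D * of_int ?z) * of_int q powr (- 1 / real M) \<le> d"
    using Y C by (simp add: Y_def field_simps)
qed

text \<open>Apply the norm bound to \<open>g(x) = q x\<^sup>M + \<Sum>i. p\<^sub>i x\<^sup>i\<^sup>-\<^sup>1\<close>. Modulo
  \<open>F(x) = (x - \<xi>\<^sub>1)\<cdots>(x - \<xi>\<^sub>M) = x\<^sup>M + \<Sum>i. \<alpha>\<^sub>i x\<^sup>i\<^sup>-\<^sup>1\<close> it has the small coefficients
  \<open>p\<^sub>i - \<alpha>\<^sub>i q\<close>, so its values at \<open>\<xi>\<^sub>1, \<dots>, \<xi>\<^sub>M\<close> are small; only the value at
  \<open>\<xi>\<^sub>M\<^sub>+\<^sub>1\<close> is of order \<open>q\<close>.\<close>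

lemma badly_approximable_with_alpha:
  assumes M: "1 \<le> M" and Q: "5 \<le> Q"
  shows "badly_approximable_with (1 / (6 * (real Q * real M) ^ M)) M (alpha M Q)"
  unfolding badly_approximable_with_iff[OF M]
proof (intro allI impI)
  fix q :: int and p :: "nat \<Rightarrow> int" and d
  assume q: "q > 0" and d: "\<forall>i\<in>{1..M}. \<bar>alpha M Q i * of_int q - of_int (p i)\<bar> \<le> d"
  define X where "X = (real Q * real M) ^ M"
  have "1 * 1 \<le> real Q * real M" using M Q by (intro mult_mono) auto
  then have X1: "1 \<le> X" unfolding X_def by (intro one_le_power) simp
  have q1: "1 \<le> real_of_int q" using q by simp
  have d0: "0 \<le> d" using d M by (meson abs_ge_zero atLeastAtMost_iff order_refl order_trans)
  have goal: "of_int q powr (- 1 / real M) \<le> 6 * X * d"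
  \<comment> \<open>The case \<open>d \<ge> 1\<close> is immediate. In the other case
    \<open>d < 1\<close> enters the estimate of \<open>G\<close> at the last root.\<close>
  proof (cases "1 \<le> d")
    case True
    have "of_int q powr (- 1 / real M) \<le> of_int q powr 0"
      using q1 by (intro powr_mono) auto
    also have "\<dots> \<le> 6 * 1 * 1" using q by simp
    also have "\<dots> \<le> 6 * X * d" using X1 True by (intro mult_mono) auto
    finally show ?thesis .
  next
    case False
    define P where "P = (\<Prod>j\<in>{1..M+1}. [:- int (j * Q), 1:]) - 1"
    have mapP: "map_poly real_of_int P = base_poly M Q"
      by (simp add: P_def base_poly_def hom_distribs)
    have degP: "degree P = M + 1"
      using degree_base_poly(1)[of M Q] unfolding mapP[symmetric] by simp
    have lcP: "lead_coeff P = 1"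
      using lead_coeff_prod[of "\<lambda>j. [:- int (j * Q), 1:]" "{1..M+1}"]
        degree_prod_linear[of "\<lambda>j. - int (j * Q)" "{1..M+1}"]
      unfolding degP by (simp add: P_def)
    have irr: "Factorial_Ring.irreducible P"
      unfolding P_def using Q by (intro irreducible_prod_linear_minus_one) (auto simp: inj_on_def)
    define g where "g = Polynomial.monom q M + (\<Sum>i<M. Polynomial.monom (p (Suc i)) i)"
    have cg: "poly.coeff g i = (if i = M then q else if i < M then p (Suc i) else 0)" for i
      by (simp add: g_def coeff_sum)
    have g0: "g \<noteq> 0" using cg[of M] q by auto
    have degg: "degree g < degree P" unfolding degP
      by (rule le_imp_less_Suc[unfolded Suc_eq_plus1], rule degree_le) (auto simp: cg)
    define \<xi> where "\<xi> = xi M Q"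
    define F where "F = (\<Prod>k=1..M. [:- \<xi> k, 1:])"
    have degF: "degree F = M" using degree_prod_linear[of "\<lambda>k. - \<xi> k" "{1..M}"] by (simp add: F_def)
    have lcF: "poly.coeff F M = 1"
      using lead_coeff_prod[of "\<lambda>k. [:- \<xi> k, 1:]" "{1..M}"] degF by (simp add: F_def)
    have polyF: "poly F x = x ^ M + (\<Sum>i<M. alpha M Q (Suc i) * x ^ i)" for x
    proof -
      have "alpha M Q (Suc i) = poly.coeff F i" if "i < M" for i
        using alpha_eq_coeff[OF Q, of "Suc i" M] that by (simp add: F_def \<xi>_def)
      then show ?thesis using degF lcF by (simp add: poly_altdef lessThan_Suc_atMost[symmetric])
    qed
    define G where "G x = poly (map_poly of_int g) x" for x :: real
    have G: "G x = of_int q * x ^ M + (\<Sum>i<M. of_int (p (Suc i)) * x ^ i)" for x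
      by (simp add: G_def g_def hom_distribs poly_sum poly_monom)
    have diff: "\<bar>of_int q * poly F x - G x\<bar> \<le> d * (1 + x) ^ (M - 1)" if "0 \<le> x" for x
    proof -
      have "of_int q * poly F x - G x = (\<Sum>i<M. (alpha M Q (Suc i) * of_int q - of_int (p (Suc i))) * x ^ i)"
        unfolding polyF G by (simp add: algebra_simps sum_distrib_left sum_subtractf)
      also have "\<bar>\<dots>\<bar> \<le> (\<Sum>i<M. d * x ^ i)"
        using d that by (intro order_trans[OF sum_abs] sum_mono)
          (auto simp: abs_mult power_abs intro!: mult_right_mono)
      also have "\<dots> = d * (\<Sum>i<Suc (M - 1). x ^ i)" using M by (simp add: sum_distrib_left)
      also have "\<dots> \<le> d * (1 + x) ^ (M - 1)"
        by (intro mult_left_mono sum_power_le_one_plus_power that d0)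
      finally show ?thesis .
    qed
    have \<xi>: "0 < \<xi> k" "1 + \<xi> k \<le> (real k + 1) * real Q" if "k \<in> {1..M+1}" for k
      using xi_bounds[OF Q that] by (simp_all add: \<xi>_def)
    have small: "\<bar>G (\<xi> k)\<bar> \<le> d * ((real k + 1) * real Q) ^ (M - 1)" if k: "k \<in> {1..M}" for k
    proof -
      have "poly F (\<xi> k) = 0" using k by (auto simp: F_def poly_prod intro!: prod_zero)
      then have "\<bar>G (\<xi> k)\<bar> \<le> d * (1 + \<xi> k) ^ (M - 1)" using diff[of "\<xi> k"] \<xi>[of k] k by simp
      also have "\<dots> \<le> d * ((real k + 1) * real Q) ^ (M - 1)"
        using \<xi>[of k] k d0 by (intro mult_left_mono power_mono) auto
      finally show ?thesis .
    qed
    have "(\<Prod>k=1..M. \<bar>G (\<xi> k)\<bar>) \<le> (\<Prod>k=1..M. d * ((real k + 1) * real Q) ^ (M - 1))"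
      using small by (intro prod_mono) auto
    also have "\<dots> = d ^ M * (\<Prod>k=1..M. (real k + 1) * real Q) ^ (M - 1)"
      by (subst prod.distrib) (simp add: prod_power_distrib)
    also have "\<dots> \<le> d ^ M * (2 * X) ^ (M - 1)"
      unfolding X_def using prod_xi_bound[OF Q M] d0
      by (intro mult_left_mono power_mono prod_nonneg) auto
    finally have first: "(\<Prod>k=1..M. \<bar>G (\<xi> k)\<bar>) \<le> d ^ M * (2 * X) ^ (M - 1)" .
    define r where "r = \<xi> (M + 1)"
    \<comment> \<open>\<open>Y\<close> dominates both \<open>1 + r\<close> and every distance from
      \<open>r\<close> to another root; the 3 comes from \<open>M + 2 \<le> 3 * M\<close>.\<close>
    define Y where "Y = 3 * real M * real Q"
    have r: "0 < r" "1 + r \<le> Y"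
    proof -
      show "0 < r" using \<xi>[of "M+1"] by (simp add: r_def)
      have "1 + r \<le> (real M + 2) * real Q" using \<xi>[of "M+1"] by (simp add: r_def add.commute)
      also have "\<dots> \<le> Y" unfolding Y_def using M by (intro mult_right_mono) auto
      finally show "1 + r \<le> Y" .
    qed
    have "\<bar>poly F r\<bar> \<le> (\<Prod>k=1..M. Y)"
    proof -
      have "\<bar>r - \<xi> k\<bar> \<le> Y" if "k \<in> {1..M}" for k
      proof -
        have "1 + \<xi> k \<le> (real k + 1) * real Q" "0 < \<xi> k" using \<xi>[of k] that by auto
        moreover have "(real k + 1) * real Q \<le> Y"
          unfolding Y_def using that by (intro mult_right_mono) auto
        ultimately show ?thesis using r by linarith
      qed
      then have "(\<Prod>k=1..M. \<bar>r - \<xi> k\<bar>) \<le> (\<Prod>k=1..M. Y)" by (intro prod_mono) auto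
      then show ?thesis by (simp add: F_def poly_prod abs_prod)
    qed
    then have Fr: "\<bar>poly F r\<bar> \<le> Y ^ M" by simp
    have "d * (1 + r) ^ (M - 1) \<le> 1 * Y ^ M"
    proof (rule mult_mono)
      have "(1 + r) ^ (M - 1) \<le> Y ^ (M - 1)" using r by (intro power_mono) auto
      also have "\<dots> \<le> Y ^ M" using r by (intro power_increasing) auto
      finally show "(1 + r) ^ (M - 1) \<le> Y ^ M" .
    qed (use False r in auto)
    moreover have "1 * Y ^ M \<le> of_int q * Y ^ M" using q1 r by (intro mult_right_mono) auto
    moreover have "\<bar>of_int q * poly F r\<bar> \<le> of_int q * Y ^ M" using Fr q1 by (simp add: abs_mult)
    ultimately have last: "\<bar>G r\<bar> \<le> 2 * (of_int q * Y ^ M)"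
      using diff[of r] r by linarith
    have "1 \<le> \<bar>\<Prod>k<degree P. G (\<xi> (Suc k))\<bar>"
      unfolding G_def
    proof (rule abs_prod_poly_roots_ge_1[OF lcP irr _ _ g0 degg])
      show "inj_on (\<lambda>k. \<xi> (Suc k)) {..<degree P}"
        unfolding degP \<xi>_def by (rule inj_onI) (auto dest!: inj_onD[OF inj_on_xi[OF Q, of M]])
      show "poly (map_poly real_of_int P) (\<xi> (Suc k)) = 0" if "k < degree P" for k
        using xi_root[OF Q, of "Suc k" M] that unfolding degP mapP \<xi>_def by simp
    qed
    also have "(\<Prod>k<degree P. G (\<xi> (Suc k))) = (\<Prod>k=1..M. G (\<xi> k)) * G r"
    proof -
      have "(\<Prod>k<M. G (\<xi> (Suc k))) = (\<Prod>k=1..M. G (\<xi> k))"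
        by (rule prod.reindex_bij_witness[of _ "\<lambda>i. i - 1" Suc]) auto
      then show ?thesis unfolding degP r_def by simp
    qed
    finally have "1 \<le> (\<Prod>k=1..M. \<bar>G (\<xi> k)\<bar>) * \<bar>G r\<bar>" by (simp add: abs_mult abs_prod)
    also have "\<dots> \<le> (d ^ M * (2 * X) ^ (M - 1)) * (2 * (of_int q * Y ^ M))"
      using first last d0 X1 by (intro mult_mono mult_nonneg_nonneg zero_le_power) auto
    \<comment> \<open>Origin of the constant 6: the factor 2 and the \<open>X\<close> contributed by
      the last root complete \<open>(2 * X) ^ (M - 1)\<close> to an \<open>M\<close>-th power, and
      \<open>Y ^ M\<close> supplies \<open>3 ^ M\<close>.\<close>
    also have "Y ^ M = 3 ^ M * X" by (simp add: Y_def X_def power_mult_distrib)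
    also have "(d ^ M * (2 * X) ^ (M - 1)) * (2 * (of_int q * (3 ^ M * X)))
        = of_int q * (d ^ M * ((2 * X) ^ (M - 1) * (2 * X)) * 3 ^ M)" by (simp add: mult_ac)
    also have "(2 * X) ^ (M - 1) * (2 * X) = (2 * X) ^ M" using M by (cases M) auto
    also have "d ^ M * (2 * X) ^ M * 3 ^ M = (6 * X * d) ^ M"
      unfolding power_mult_distrib[symmetric] by (simp add: mult_ac)
    finally have main: "1 / of_int q \<le> (6 * X * d) ^ M" using q1 by (simp add: field_simps)
    have "(of_int q powr (- 1 / real M)) ^ M = (of_int q powr (- 1 / real M)) powr real M"
      using q by (simp add: powr_realpow)
    also have "\<dots> = of_int q powr (- 1)" using M by (simp add: powr_powr)
    also have "\<dots> = 1 / of_int q" using q by (simp add: powr_minus inverse_eq_divide)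
    finally have "(of_int q powr (- 1 / real M)) ^ M = 1 / of_int q" .
    with main have "(of_int q powr (- 1 / real M)) ^ M \<le> (6 * X * d) ^ M" by simp
    then show ?thesis
      using M X1 d0 power_mono_iff[of "of_int q powr (- 1 / real M)" "6 * X * d" M] by simp
  qed
  then show "1 / (6 * (real Q * real M) ^ M) * of_int q powr (- 1 / real M) \<le> d"
    using X1 by (simp add: X_def field_simps)
qed

section \<open>Combination of the bounds\<close>

text \<open>The constant \<open>B0\<close> comes from fractions for \<open>a'\<close> and
  \<open>b'\<close> and is chosen before \<open>M\<close> and \<open>Q\<close>. The condition
  \<open>Q \<le> M\<^sup>2\<close> gives \<open>(Q * M) ^ M \<le> exp (3 * M * ln M)\<close>, which
  yields the location of the points and the explicit constant; integers with
  \<open>5 * (M + 1) \<le> Q \<le> M\<^sup>2\<close> exist as soon as \<open>M \<ge> 6\<close>. For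
  larger \<open>Q\<close> the constant of bad approximability depends on \<open>Q\<close> as
  well.\<close>

theorem theorem1:
  fixes a b a' b' :: real
  assumes "a < b"
    and "a' \<in> \<rat>" and "b' \<in> \<rat>" and "a' < b'" and "{a'<..<b'} \<subseteq> {a<..<b}"
  shows "\<exists>B0>0. \<forall>\<^sub>F M in sequentially. \<forall>Q \<ge> 5 * (M + 1).
           (let \<beta> = beta a' b' M (alpha M Q);
                \<beta>' = beta a' b' M (\<lambda>l. \<bar>alpha M Q l\<bar>);
                B = B0 * exp (- 6 * real M * ln (real M))
            in badly_approximable M \<beta> \<and> badly_approximable M \<beta>' \<and>
               (Q \<le> M\<^sup>2 \<longrightarrow>
                  (\<forall>l\<in>{1..M}. \<beta>' l \<in> {a<..<b}) \<and>
                  badly_approximable_with B M \<beta> \<and> badly_approximable_with B M \<beta>'))"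
proof -
  obtain m1 n1 :: int where 1: "n1 > 0" "a' = of_int m1 / of_int n1"
    using assms(2) by (metis Rats_cases')
  obtain m2 n2 :: int where 2: "n2 > 0" "b' = of_int m2 / of_int n2"
    using assms(3) by (metis Rats_cases')
  define A where "A = m1 * n2"
  define D where "D = n1 * n2"
  define C where "C = m2 * n1 - A"
  have D: "0 < D" using 1 2 by (simp add: D_def)
  have a: "a' = of_int A / of_int D" using 1 2 by (simp add: A_def D_def)
  have ab: "b' - a' = of_int C / of_int D" unfolding 1(2) 2(2) using 1(1) 2(1)
    by (simp add: A_def C_def D_def field_simps)
  have "0 < real_of_int C / real_of_int D" using assms(4) unfolding ab[symmetric] by simp
  then have C: "0 < C" using D by (simp add: zero_less_divide_iff)
  \<comment> \<open>Here \<open>186 = 6 * 31\<close>: the 6 is the constant for \<alpha>, and 31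
    bounds the ratio of \<open>scale M\<close> to \<open>exp (3 * M * ln M)\<close>.\<close>
  define B0 where "B0 = 1 / (186 * real_of_int C * real_of_int D)"
  have "0 < B0" using C D by (simp add: B0_def)
  moreover have "\<forall>\<^sub>F M in sequentially. \<forall>Q \<ge> 5 * (M + 1).
           (let \<beta> = beta a' b' M (alpha M Q);
                \<beta>' = beta a' b' M (\<lambda>l. \<bar>alpha M Q l\<bar>);
                B = B0 * exp (- 6 * real M * ln (real M))
            in badly_approximable M \<beta> \<and> badly_approximable M \<beta>' \<and>
               (Q \<le> M\<^sup>2 \<longrightarrow>
                  (\<forall>l\<in>{1..M}. \<beta>' l \<in> {a<..<b}) \<and>
                  badly_approximable_with B M \<beta> \<and> badly_approximable_with B M \<beta>'))"
    using eventually_ge_at_top[of "1::nat"]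
  proof (eventually_elim, intro allI impI)
    fix M Q :: nat
    assume M: "1 \<le> M" and "5 * (M + 1) \<le> Q"
    then have Q: "5 \<le> Q" by simp
    define X where "X = (real Q * real M) ^ M"
    define z where "z = real_of_int (scale M)"
    define E where "E = exp (3 * real M * ln (real M))"
    define B where "B = 1 / (6 * X) / (of_int C * of_int D * z)"
    have X: "0 < X" using Q M by (simp add: X_def)
    have z: "0 < z" using scale_pos by (simp add: z_def)
    have ba: "badly_approximable_with B M (beta a' b' M \<alpha>)"
      if "badly_approximable_with (1 / (6 * X)) M \<alpha>" for \<alpha>
      unfolding B_def z_def using X by (intro badly_approximable_with_beta[OF M that _ C D a ab]) simp
    have ba1: "badly_approximable_with B M (beta a' b' M (alpha M Q))"
      using badly_approximable_with_alpha[OF M Q] by (intro ba) (simp add: X_def)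
    have ba2: "badly_approximable_with B M (beta a' b' M (\<lambda>l. \<bar>alpha M Q l\<bar>))"
      using badly_approximable_with_abs[OF M badly_approximable_with_alpha[OF M Q]]
      by (intro ba) (simp add: X_def)
    have Bpos: "0 < B" using X z C D by (simp add: B_def)
    \<comment> \<open>As a power of \<open>M\<close>, \<open>E\<close> equals
      \<open>(M\<^sup>2 * M) ^ M\<close>, the bound for \<open>X\<close> that
      \<open>Q \<le> M\<^sup>2\<close> provides.\<close>
    have E: "E = real M ^ (3 * M)" "1 \<le> E"
      using M by (simp_all add: E_def exp_of_nat_mult[of "3 * M" "ln (real M)", simplified])
    have quant: "(\<forall>l\<in>{1..M}. beta a' b' M (\<lambda>l. \<bar>alpha M Q l\<bar>) l \<in> {a<..<b}) \<and>
       B0 * exp (- 6 * real M * ln (real M)) \<le> B" if QM: "Q \<le> M\<^sup>2"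
    proof
      have "real Q * real M \<le> (real M)\<^sup>2 * real M"
        using QM by (intro mult_right_mono) (simp_all flip: of_nat_power)
      then have "X \<le> ((real M)\<^sup>2 * real M) ^ M" unfolding X_def by (intro power_mono) auto
      also have "\<dots> = E" unfolding E(1) power_mult by (simp add: power2_eq_square power3_eq_cube)
      finally have XE: "X \<le> E" .
      show "\<forall>l\<in>{1..M}. beta a' b' M (\<lambda>l. \<bar>alpha M Q l\<bar>) l \<in> {a<..<b}"
      proof
        fix l assume l: "l \<in> {1..M}"
        let ?x = "\<bar>alpha M Q l\<bar>"
        have "?x \<le> 2 * X" using abs_alpha_bounds(2)[OF Q l] by (simp add: X_def)
        also have "\<dots> < 30 * E" using XE E by simp
        also have "\<dots> \<le> z" using scale_bounds(1)[of M] by (simp add: E_def z_def)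
        finally have "?x < z" .
        then have "?x * (b' - a') < z * (b' - a')" using assms(4) by (intro mult_strict_right_mono) auto
        then have "?x * (b' - a') / z < b' - a'" using z by (simp add: pos_divide_less_eq mult.commute)
        moreover have "0 < ?x * (b' - a') / z"
          using z assms(4) abs_alpha_bounds(1)[OF Q l] by simp
        ultimately have "beta a' b' M (\<lambda>l. \<bar>alpha M Q l\<bar>) l \<in> {a'<..<b'}"
          by (simp add: beta_def z_def)
        then show "beta a' b' M (\<lambda>l. \<bar>alpha M Q l\<bar>) l \<in> {a<..<b}" using assms(5) by blast
      qed
      \<comment> \<open>Rounding up adds at most 1, which \<open>1 \<le> E\<close> absorbs.\<close>
      have "z \<le> 31 * E" using scale_bounds(2)[of M] E(2) unfolding E_def z_def by linarith
      then have "X * z \<le> E * (31 * E)" using XE X z by (intro mult_mono) auto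
      then have "1 / (E * E) \<le> 31 / (X * z)" using X z E(2) by (simp add: field_simps)
      moreover have "exp (- 6 * real M * ln (real M)) = 1 / (E * E)"
        by (simp add: E_def exp_minus inverse_eq_divide flip: exp_add)
      ultimately have "exp (- 6 * real M * ln (real M)) \<le> 31 / (X * z)" by simp
      then have "B0 * exp (- 6 * real M * ln (real M)) \<le> B0 * (31 / (X * z))"
        using \<open>0 < B0\<close> by (intro mult_left_mono) auto
      also have "\<dots> = B" by (simp add: B0_def B_def)
      finally show "B0 * exp (- 6 * real M * ln (real M)) \<le> B" .
    qed
    show "let \<beta> = beta a' b' M (alpha M Q);
                \<beta>' = beta a' b' M (\<lambda>l. \<bar>alpha M Q l\<bar>);
                B = B0 * exp (- 6 * real M * ln (real M))
            in badly_approximable M \<beta> \<and> badly_approximable M \<beta>' \<and>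
               (Q \<le> M\<^sup>2 \<longrightarrow>
                  (\<forall>l\<in>{1..M}. \<beta>' l \<in> {a<..<b}) \<and>
                  badly_approximable_with B M \<beta> \<and> badly_approximable_with B M \<beta>')"
      unfolding Let_def
    proof (intro conjI impI)
      show "badly_approximable M (beta a' b' M (alpha M Q))"
        "badly_approximable M (beta a' b' M (\<lambda>l. \<bar>alpha M Q l\<bar>))"
        unfolding badly_approximable_def using ba1 ba2 Bpos by blast+
    qed (use quant ba1 ba2 badly_approximable_with_mono[OF M] in blast)+
  qed
  ultimately show ?thesis by blast
qed

end
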